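(* Let $N\ge 1$. The dual cone $\mathcal{K}^*$ of the cone $\mathcal{K}$ is $$\mathcal{K}^* = \left\{ \lambda=\begin{pmatrix}\rho\\ s\\ z\end{pmatrix} : \rho>0,\ \ z-\frac{1}{4\rho}T^*(ss^{\mathrm H})\in\mathcal{C}^*\right\}\ \cup\ \left\{\lambda=\begin{pmatrix}\rho\\ s\\ z\end{pmatrix} : \rho=0,\ s=0,\ z\in\mathcal{C}^*\right\},$$ where $\rho\in\mathbb{R}$, $s\in\mathbb{C}^N$, $z\in\mathbb{R}^{2N-1}$.
   Context: Vectors are indexed from $0$ and $j=\sqrt{-1}$. For $u=(u_0,\dots,u_{2N-2})^{\mathrm T}\in\mathbb{R}^{2N-1}$, $T(u)\in\mathbb{C}^{N\times N}$ is the Hermitian Toeplitz matrix whose first row is $(2u_0,\,u_1+ju_N,\,u_2+ju_{N+1},\dots,\,u_{N-1}+ju_{2N-2})$. The map $T^*$ sends a Hermitian matrix $B\in\mathbb{C}^{N\times N}$ to the vector $T^*(B)\in\mathbb{R}^{2N-1}$ determined by $\operatorname{tr}(T(u)^{\mathrm H}B)=T^*(B)^{\mathrm T}u$ for all $u\in\mathbb{R}^{2N-1}$. The cone $\mathcal{K}$ is the set of all $\mu=(v,x,u)$ with $v\in\mathbb{R}$, $x\in\mathbb{C}^N$, $u\in\mathbb{R}^{2N-1}$ such that $\begin{pmatrix}T(u)&x\\ x^{\mathrm H}&v\end{pmatrix}\succeq0$ (positive semidefinite). For $\lambda=(\rho,s,z)$ with $\rho\in\mathbb{R}$, $s\in\mathbb{C}^N$,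 $z\in\mathbb{R}^{2N-1}$, the inner product is $\langle\lambda,\mu\rangle=\rho v+\operatorname{Re}(s^{\mathrm H}x)+z^{\mathrm T}u$, and $\mathcal{K}^*=\{\lambda:\langle\lambda,\mu\rangle\ge0\ \forall\mu\in\mathcal{K}\}$. Further, $\mathcal{C}=\{u\in\mathbb{R}^{2N-1}:T(u)\succeq0\}$ and $\mathcal{C}^*=\{z\in\mathbb{R}^{2N-1}: z^{\mathrm T}u\ge0\ \forall u\in\mathcal{C}\}$. *)

theory Defs
  imports "Jordan_Normal_Form.Schur_Decomposition"
begin

definition trace :: "'a::comm_monoid_add mat \<Rightarrow> 'a" where
  "trace A = (\<Sum>i<dim_row A. A $$ (i, i))"

definition hermitian :: "complex mat \<Rightarrow> bool" where
  "hermitian A \<longleftrightarrow> mat_adjoint A = A"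

(* The scalar product below is w^H A w. In the order on complex numbers, 0 \<le> c means that
   c is real and nonnegative. *)
definition psd :: "complex mat \<Rightarrow> bool" where
  "psd A \<longleftrightarrow> hermitian A \<and> (\<forall>w \<in> carrier_vec (dim_row A). 0 \<le> (A *\<^sub>v w) \<bullet>c w)"

abbreviation as_column :: "'a vec \<Rightarrow> 'a mat" where
  "as_column x \<equiv> mat_of_cols (dim_vec x) [x]"

(* Entry (i, k) with i < k is u_d + j u_(N-1+d), where d = k - i. *)
definition toeplitz :: "nat \<Rightarrow> real vec \<Rightarrow> complex mat" where
  "toeplitz N u = mat N N (\<lambda>(i, k).
     if i = k then complex_of_real (2 * u $ 0)
     else if i < k then Complex (u $ (k - i)) (u $ (N - 1 + (k - i)))
     else cnj (Complex (u $ (i - k)) (u $ (N - 1 + (i - k)))))"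

(* Meaningful for Hermitian B of size N \<ge> 1; see toeplitz_adjoint_unique. *)
definition toeplitz_adjoint :: "nat \<Rightarrow> complex mat \<Rightarrow> real vec" where
  "toeplitz_adjoint N B = (THE w. w \<in> carrier_vec (2 * N - 1) \<and>
     (\<forall>u \<in> carrier_vec (2 * N - 1).
        trace (mat_adjoint (toeplitz N u) * B) = complex_of_real (w \<bullet> u)))"

definition cone_K :: "nat \<Rightarrow> (real \<times> complex vec \<times> real vec) set" where
  "cone_K N = {(v, x, u). x \<in> carrier_vec N \<and> u \<in> carrier_vec (2 * N - 1) \<and>
     psd (four_block_mat (toeplitz N u) (as_column x)
            (mat_adjoint (as_column x)) (mat 1 1 (\<lambda>_. complex_of_real v)))}"

definition pairing ::
    "real \<times> complex vec \<times> real vec \<Rightarrow> real \<times> complex vec \<times> real vec \<Rightarrow> real" where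
  "pairing = (\<lambda>(\<rho>, s, z) (v, x, u). \<rho> * v + Re (conjugate s \<bullet> x) + z \<bullet> u)"

definition dual_cone_K :: "nat \<Rightarrow> (real \<times> complex vec \<times> real vec) set" where
  "dual_cone_K N = {(\<rho>, s, z). s \<in> carrier_vec N \<and> z \<in> carrier_vec (2 * N - 1) \<and>
     (\<forall>\<mu> \<in> cone_K N. 0 \<le> pairing (\<rho>, s, z) \<mu>)}"

definition cone_C :: "nat \<Rightarrow> real vec set" where
  "cone_C N = {u \<in> carrier_vec (2 * N - 1). psd (toeplitz N u)}"

definition dual_cone_C :: "nat \<Rightarrow> real vec set" where
  "dual_cone_C N = {z \<in> carrier_vec (2 * N - 1). \<forall>u \<in> cone_C N. 0 \<le> z \<bullet> u}"

lemma toeplitz_carrier [simp]: "toeplitz N u \<in> carrier_mat N N"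
  by (simp add: toeplitz_def)

lemma mat_adjoint_index:
  assumes "i < dim_col A" "k < dim_row A"
  shows "mat_adjoint A $$ (i, k) = conjugate (A $$ (k, i))"
  using assms by (simp add: mat_adjoint_def mat_of_rows_def)

lemma mat_adjoint_dims [simp]:
  "dim_row (mat_adjoint A) = dim_col A" "dim_col (mat_adjoint A) = dim_row A"
  by (simp_all add: mat_adjoint_def)

lemma hermitian_toeplitz: "hermitian (toeplitz N u)"
  unfolding hermitian_def
  by (rule eq_matI) (auto simp: mat_adjoint_index toeplitz_def complex_eq_iff)

lemma toeplitz_adjoint_unique:
  assumes N: "N \<ge> 1" and B: "B \<in> carrier_mat N N" and H: "hermitian B"
  shows "\<exists>!w. w \<in> carrier_vec (2 * N - 1) \<and>
     (\<forall>u \<in> carrier_vec (2 * N - 1).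
        trace (mat_adjoint (toeplitz N u) * B) = complex_of_real (w \<bullet> u))"
proof -
  let ?M = "2 * N - 1"
  let ?f = "\<lambda>u. trace (mat_adjoint (toeplitz N u) * B)"
  have f: "?f u = (\<Sum>i<N. \<Sum>k<N. toeplitz N u $$ (i, k) * B $$ (k, i))" for u
  proof -
    have "mat_adjoint (toeplitz N u) = toeplitz N u"
      using hermitian_toeplitz by (simp add: hermitian_def)
    moreover have "dim_row (toeplitz N u) = N" "dim_col (toeplitz N u) = N"
      by (auto simp: toeplitz_def)
    ultimately show ?thesis using B
      by (simp add: trace_def scalar_prod_def atLeast0LessThan)
  qed
  have Bc: "cnj (B $$ (k, i)) = B $$ (i, k)" if "i < N" "k < N" for i k
    using mat_adjoint_index[of i B k] H B that by (simp add: hermitian_def)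
  have Tc: "cnj (toeplitz N u $$ (k, i)) = toeplitz N u $$ (i, k)" if "i < N" "k < N" for i k u
    using that by (simp add: toeplitz_def complex_eq_iff)
  have real: "cnj (?f u) = ?f u" for u
  proof -
    have "cnj (?f u) = (\<Sum>i<N. \<Sum>k<N. toeplitz N u $$ (k, i) * B $$ (i, k))"
      unfolding f by (simp add: Bc Tc)
    also have "\<dots> = ?f u"
      unfolding f by (rule sum.swap)
    finally show ?thesis .
  qed
  have T: "toeplitz N u $$ (i, k) =
      (\<Sum>m<?M. complex_of_real (u $ m) * toeplitz N (unit_vec ?M m) $$ (i, k))"
    if "i < N" "k < N" for u i k
  proof -
    have delta: "(\<Sum>m<?M. u $ m * unit_vec ?M m $ a) = u $ a" if "a < ?M" for a
    proof -
      have "(\<Sum>m<?M. u $ m * unit_vec ?M m $ a) = (\<Sum>m<?M. if m = a then u $ m else 0)"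
        using that by (intro sum.cong) (auto simp: unit_vec_def)
      also have "\<dots> = u $ a" using that by simp
      finally show ?thesis .
    qed
    have delta2: "(\<Sum>m<?M. u $ m * (2 * unit_vec ?M m $ 0)) = 2 * u $ 0"
    proof -
      have "(\<Sum>m<?M. u $ m * (2 * unit_vec ?M m $ 0)) = 2 * (\<Sum>m<?M. u $ m * unit_vec ?M m $ 0)"
        unfolding sum_distrib_left by (intro sum.cong) auto
      also have "\<dots> = 2 * u $ 0" using delta[of 0] N by simp
      finally show ?thesis .
    qed
    consider "i = k" | "i < k" | "k < i" by linarith
    then show ?thesis
    proof cases
      case 1
      with that delta2 show ?thesis
        by (simp add: toeplitz_def complex_eq_iff)
    next
      case 2
      with that have "k - i < ?M" "N - 1 + (k - i) < ?M" by auto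
      with 2 that show ?thesis using delta[of "k - i"] delta[of "N - 1 + (k - i)"]
        by (simp add: toeplitz_def complex_eq_iff)
    next
      case 3
      with that have "i - k < ?M" "N - 1 + (i - k) < ?M" by auto
      with 3 that show ?thesis using delta[of "i - k"] delta[of "N - 1 + (i - k)"]
        by (simp add: toeplitz_def complex_eq_iff sum_negf)
    qed
  qed
  let ?w = "vec ?M (\<lambda>m. Re (?f (unit_vec ?M m)))"
  have ex: "?f u = complex_of_real (?w \<bullet> u)" if u: "u \<in> carrier_vec ?M" for u
  proof -
    have r: "complex_of_real (Re (?f v)) = ?f v" for v
      using real[of v] by (simp add: complex_eq_iff)
    have "?f u = (\<Sum>i<N. \<Sum>k<N. \<Sum>m<?M.
        complex_of_real (u $ m) * (toeplitz N (unit_vec ?M m) $$ (i, k) * B $$ (k, i)))"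
      unfolding f
      by (intro sum.cong refl) (subst T, auto simp: sum_distrib_right mult.assoc)
    also have "\<dots> = (\<Sum>i<N. \<Sum>m<?M. \<Sum>k<N.
        complex_of_real (u $ m) * (toeplitz N (unit_vec ?M m) $$ (i, k) * B $$ (k, i)))"
      by (intro sum.cong refl sum.swap)
    also have "\<dots> = (\<Sum>m<?M. \<Sum>i<N. \<Sum>k<N.
        complex_of_real (u $ m) * (toeplitz N (unit_vec ?M m) $$ (i, k) * B $$ (k, i)))"
      by (rule sum.swap)
    also have "\<dots> = (\<Sum>m<?M. complex_of_real (u $ m) * ?f (unit_vec ?M m))"
      unfolding f by (simp add: sum_distrib_left)
    also have "\<dots> = (\<Sum>m<?M. complex_of_real (Re (?f (unit_vec ?M m)) * u $ m))"
      by (simp add: r mult.commute)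
    also have "\<dots> = complex_of_real (?w \<bullet> u)"
      using u by (simp add: scalar_prod_def atLeast0LessThan)
    finally show ?thesis .
  qed
  show ?thesis
  proof (rule ex1I[of _ ?w])
    show "?w \<in> carrier_vec ?M \<and> (\<forall>u \<in> carrier_vec ?M. ?f u = complex_of_real (?w \<bullet> u))"
      by (intro conjI ballI ex) simp_all
  next
    fix w
    assume w: "w \<in> carrier_vec ?M \<and> (\<forall>u \<in> carrier_vec ?M. ?f u = complex_of_real (w \<bullet> u))"
    show "w = ?w"
    proof (rule eq_vecI)
      fix m assume "m < dim_vec ?w"
      then have m: "m < ?M" by simp
      from w have "?f (unit_vec ?M m) = complex_of_real (w \<bullet> unit_vec ?M m)" by (meson unit_vec_carrier)
      also have "w \<bullet> unit_vec ?M m = w $ m" using w m by (simp add: scalar_prod_right_unit)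
      finally show "w $ m = ?w $ m" using m by simp
    qed (use w in auto)
  qed
qed

end

theory Submission
  imports Defs
begin

text \<open>
  Let \<open>q = s\<^sup>H T(u) s\<close>. Evaluating the bordered form of \<open>(v, x, u) \<in> K\<close> at the vector \<open>(s, 2\<rho>)\<close>
  gives \<open>\<rho> v + Re (s\<^sup>H x) \<ge> - q / (4\<rho>)\<close>, and \<open>T*(s s\<^sup>H) \<bullet> u = q\<close>; this is the inclusion from
  right to left for \<open>\<rho> > 0\<close>. Conversely, for \<open>u \<in> C\<close> and real \<open>k\<close> the triple
  \<open>(k\<^sup>2 q, - k T(u) s, u)\<close> lies in \<open>K\<close>, because its bordered form at \<open>(w, t)\<close> is that of \<open>T(u)\<close>
  at \<open>w - t k s\<close>. Hence every \<open>(\<rho>, s, z)\<close> in the dual cone satisfies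
  \<open>\<rho> k\<^sup>2 q - k q + z \<bullet> u \<ge> 0\<close>. For \<open>\<rho> > 0\<close> take the minimizer \<open>k = 1 / (2\<rho>)\<close>; for \<open>\<rho> = 0\<close>
  arbitrary \<open>k\<close> force \<open>q = 0\<close>, and \<open>T(u) = I\<close> yields \<open>s = 0\<close>.
\<close>

section \<open>Hermitian forms\<close>

lemma hermitian_form_swap:
  assumes A: "A \<in> carrier_mat n n" and H: "hermitian A"
    and v: "v \<in> carrier_vec n" and w: "w \<in> carrier_vec n"
  shows "w \<bullet>c (A *\<^sub>v v) = (A *\<^sub>v w) \<bullet>c v"
proof -
  have h: "cnj (A $$ (i, k)) = A $$ (k, i)" if "i < n" "k < n" for i k
    using mat_adjoint_index[of k A i] A H that by (simp add: hermitian_def)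
  have "w \<bullet>c (A *\<^sub>v v) = (\<Sum>i<n. \<Sum>k<n. w $ i * (A $$ (k, i) * cnj (v $ k)))"
    using A v w by (simp add: scalar_prod_def atLeast0LessThan sum_distrib_left h)
  also have "\<dots> = (\<Sum>k<n. \<Sum>i<n. w $ i * (A $$ (k, i) * cnj (v $ k)))"
    by (rule sum.swap)
  also have "\<dots> = (A *\<^sub>v w) \<bullet>c v"
    using A v w by (simp add: scalar_prod_def atLeast0LessThan sum_distrib_left mult_ac)
  finally show ?thesis .
qed

lemma psd_form_real:
  assumes "psd A" "A \<in> carrier_mat n n" "w \<in> carrier_vec n"
  shows "(A *\<^sub>v w) \<bullet>c w = complex_of_real (Re ((A *\<^sub>v w) \<bullet>c w))"
    and "0 \<le> Re ((A *\<^sub>v w) \<bullet>c w)"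
  using assms by (auto simp: psd_def less_eq_complex_def complex_eq_iff)

lemma quadratic_form_add_smult:
  fixes A :: "complex mat"
  assumes A: "A \<in> carrier_mat n n" and w: "w \<in> carrier_vec n" and y: "y \<in> carrier_vec n"
  shows "(A *\<^sub>v (w + t \<cdot>\<^sub>v y)) \<bullet>c (w + t \<cdot>\<^sub>v y) =
    (A *\<^sub>v w) \<bullet>c w + t * ((A *\<^sub>v y) \<bullet>c w) + cnj t * ((A *\<^sub>v w) \<bullet>c y) + t * cnj t * ((A *\<^sub>v y) \<bullet>c y)"
proof -
  have Aw: "A *\<^sub>v w \<in> carrier_vec n" and Ay: "A *\<^sub>v y \<in> carrier_vec n"
    using A w y by auto
  have "A *\<^sub>v (w + t \<cdot>\<^sub>v y) = A *\<^sub>v w + t \<cdot>\<^sub>v (A *\<^sub>v y)"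
    using A w y by (simp add: mult_add_distrib_mat_vec mult_mat_vec)
  moreover have "conjugate (w + t \<cdot>\<^sub>v y) = conjugate w + cnj t \<cdot>\<^sub>v conjugate y"
    using w y by (simp add: conjugate_add_vec[of _ n] conjugate_smult_vec)
  ultimately show ?thesis
    using Aw Ay w y
    by (simp add: add_scalar_prod_distrib[of _ n] scalar_prod_add_distrib[of _ n] algebra_simps)
qed

section \<open>Bordered matrices and their quadratic forms\<close>

abbreviation bordered :: "complex mat \<Rightarrow> complex vec \<Rightarrow> real \<Rightarrow> complex mat" where
  "bordered A x v \<equiv> four_block_mat A (as_column x)
     (mat_adjoint (as_column x)) (mat 1 1 (\<lambda>_. complex_of_real v))"

lemma hermitian_bordered:
  assumes "A \<in> carrier_mat n n" "x \<in> carrier_vec n" "hermitian A"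
  shows "hermitian (bordered A x v)"
proof -
  have h: "cnj (A $$ (k, i)) = A $$ (i, k)" if "i < n" "k < n" for i k
    using mat_adjoint_index[of i A k] assms that by (simp add: hermitian_def)
  show ?thesis
    unfolding hermitian_def
    by (rule eq_matI) (use assms in \<open>auto simp: mat_adjoint_index mat_of_cols_def h\<close>)
qed

lemma bordered_quadratic_form:
  assumes A: "A \<in> carrier_mat n n" and x: "x \<in> carrier_vec n" and w: "w \<in> carrier_vec n"
  and W_def: "W = w @\<^sub>v vec 1 (\<lambda>_. t)"
  shows "(bordered A x v *\<^sub>v W) \<bullet>c W =
    (A *\<^sub>v w) \<bullet>c w + t * (x \<bullet>c w) + cnj t * (w \<bullet>c x) + t * cnj t * v"
proof -
  let ?t = "vec 1 (\<lambda>_. t)" and ?D = "mat 1 1 (\<lambda>_. complex_of_real v)"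
  have dx: "dim_vec x = n" and dw: "dim_vec w = n" using x w by auto
  have Bt: "as_column x *\<^sub>v ?t = t \<cdot>\<^sub>v x"
    by (rule eq_vecI) (auto simp: mat_of_cols_def scalar_prod_def)
  have Cw: "mat_adjoint (as_column x) *\<^sub>v w = vec 1 (\<lambda>_. w \<bullet>c x)"
    by (rule eq_vecI)
      (auto simp: dx dw mat_of_cols_def mat_adjoint_index scalar_prod_def intro!: sum.cong)
  have Dt: "?D *\<^sub>v ?t = vec 1 (\<lambda>_. v * t)"
    by (rule eq_vecI) (auto simp: scalar_prod_def)
  have "bordered A x v *\<^sub>v W = (A *\<^sub>v w + as_column x *\<^sub>v ?t)
      @\<^sub>v (mat_adjoint (as_column x) *\<^sub>v w + ?D *\<^sub>v ?t)"
    unfolding W_def by (rule four_block_mat_mult_vec[of _ n n _ 1 _ 1]) (use A x w in auto)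
  also have "\<dots> = (A *\<^sub>v w + t \<cdot>\<^sub>v x) @\<^sub>v vec 1 (\<lambda>_. w \<bullet>c x + v * t)"
    unfolding Bt Cw Dt by (intro arg_cong2[where f = append_vec] refl eq_vecI) auto
  finally have "bordered A x v *\<^sub>v W = (A *\<^sub>v w + t \<cdot>\<^sub>v x) @\<^sub>v vec 1 (\<lambda>_. w \<bullet>c x + v * t)" .
  moreover have "conjugate W = conjugate w @\<^sub>v vec 1 (\<lambda>_. cnj t)"
    unfolding W_def by (rule eq_vecI) (auto simp: dw)
  moreover have "((A *\<^sub>v w + t \<cdot>\<^sub>v x) @\<^sub>v vec 1 (\<lambda>_. w \<bullet>c x + v * t)) \<bullet> (conjugate w @\<^sub>v vec 1 (\<lambda>_. cnj t))
      = (A *\<^sub>v w + t \<cdot>\<^sub>v x) \<bullet>c w + vec 1 (\<lambda>_. w \<bullet>c x + v * t) \<bullet> vec 1 (\<lambda>_. cnj t)"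
    by (rule scalar_prod_append[of _ n _ 1]) (use A x w in auto)
  moreover have "(A *\<^sub>v w + t \<cdot>\<^sub>v x) \<bullet>c w = (A *\<^sub>v w) \<bullet>c w + t * (x \<bullet>c w)"
    using A x w by (simp add: add_scalar_prod_distrib[of _ n])
  ultimately show ?thesis
    by (simp add: scalar_prod_def algebra_simps)
qed

text \<open>A vector of length \<open>n + 1\<close> is the same as a pair of a vector
  \<open>w\<close> and a scalar \<open>t\<close>, and the bordering preserves Hermitian symmetry
  because the corner is real. This trades block matrices for a scalar inequality that can be tested
  at chosen pairs.\<close>

lemma psd_bordered_iff:
  assumes A: "A \<in> carrier_mat n n" and x: "x \<in> carrier_vec n" and H: "hermitian A"
  shows "psd (bordered A x v) \<longleftrightarrow> (\<forall>w \<in> carrier_vec n. \<forall>t.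
    0 \<le> (A *\<^sub>v w) \<bullet>c w + t * (x \<bullet>c w) + cnj t * (w \<bullet>c x) + t * cnj t * v)"
    (is "_ \<longleftrightarrow> (\<forall>w \<in> _. \<forall>t. 0 \<le> ?q w t)")
proof -
  have dim: "dim_row (bordered A x v) = n + 1"
    using A by simp
  have split: "\<exists>w t. w \<in> carrier_vec n \<and> W = w @\<^sub>v vec 1 (\<lambda>_. t)"
    if "W \<in> carrier_vec (n + 1)" for W :: "complex vec"
    using that
    by (intro exI[of _ "vec n (($) W)"] exI[of _ "W $ n"] conjI eq_vecI) (auto simp: less_Suc_eq)
  have join: "w @\<^sub>v vec 1 (\<lambda>_. t) \<in> carrier_vec (n + 1)" if "w \<in> carrier_vec n"
    for w :: "complex vec" and t
    using that by (intro append_carrier_vec) auto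
  show ?thesis
    unfolding psd_def dim using hermitian_bordered[OF A x H] join split
    by (metis bordered_quadratic_form[OF A x _ refl])
qed

text \<open>A border in the range of \<open>A\<close> lets one complete the square: the bordered
  form at \<open>(w, t)\<close> is the form of \<open>A\<close> at \<open>w + t y\<close>. The
  corner is the smallest possible one for this border, as the pair \<open>(-y, 1)\<close>
  shows.\<close>

lemma psd_bordered_mult_vec:
  assumes A: "A \<in> carrier_mat n n" and P: "psd A" and y: "y \<in> carrier_vec n"
    and v: "v = Re ((A *\<^sub>v y) \<bullet>c y)"
  shows "psd (bordered A (A *\<^sub>v y) v)"
proof -
  have H: "hermitian A" and Ay: "A *\<^sub>v y \<in> carrier_vec n"
    using P A y by (auto simp: psd_def)
  show ?thesis
    unfolding psd_bordered_iff[OF A Ay H]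
  proof (intro ballI allI)
    fix w :: "complex vec" and t
    assume w: "w \<in> carrier_vec n"
    have "0 \<le> (A *\<^sub>v (w + t \<cdot>\<^sub>v y)) \<bullet>c (w + t \<cdot>\<^sub>v y)"
      using P A w y by (auto simp: psd_def)
    also have "\<dots> = (A *\<^sub>v w) \<bullet>c w + t * ((A *\<^sub>v y) \<bullet>c w) + cnj t * (w \<bullet>c (A *\<^sub>v y))
        + t * cnj t * v"
      \<comment> \<open>Hermitian symmetry matches the mixed terms, and the form at \<open>y\<close>
        is real, so it agrees with the real corner \<open>v\<close>.\<close>
      unfolding v quadratic_form_add_smult[OF A w y] hermitian_form_swap[OF A H y w]
        psd_form_real(1)[OF P A y, symmetric] ..
    finally show "0 \<le> (A *\<^sub>v w) \<bullet>c w + t * ((A *\<^sub>v y) \<bullet>c w) + cnj t * (w \<bullet>c (A *\<^sub>v y))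
        + t * cnj t * v" .
  qed
qed

section \<open>The vector T*(s s^H) and the quadratic form of T(u) at s\<close>

lemma toeplitz_adjoint_rank_one:
  assumes N: "N \<ge> 1" and s: "s \<in> carrier_vec N"
  defines "a \<equiv> toeplitz_adjoint N (as_column s * mat_adjoint (as_column s))"
  shows "a \<in> carrier_vec (2 * N - 1)"
    and "u \<in> carrier_vec (2 * N - 1) \<Longrightarrow> a \<bullet> u = Re ((toeplitz N u *\<^sub>v s) \<bullet>c s)"
proof -
  let ?B = "as_column s * mat_adjoint (as_column s)"
  have ds: "dim_vec s = N" using s by auto
  have B: "?B \<in> carrier_mat N N" using s by auto
  have Bi: "?B $$ (i, k) = s $ i * cnj (s $ k)" if "i < N" "k < N" for i k
    using that by (simp add: ds mat_of_cols_def mat_adjoint_index scalar_prod_def)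
  \<comment> \<open>\<open>toeplitz_adjoint\<close> is a definite description. Its defining property
    is available only after unique existence, which is known for Hermitian arguments.\<close>
  have H: "hermitian ?B"
    unfolding hermitian_def
    by (rule eq_matI) (auto simp: ds mat_of_cols_def mat_adjoint_index scalar_prod_def)
  have *: "a \<in> carrier_vec (2 * N - 1) \<and> (\<forall>u \<in> carrier_vec (2 * N - 1).
      trace (mat_adjoint (toeplitz N u) * ?B) = complex_of_real (a \<bullet> u))"
    unfolding a_def toeplitz_adjoint_def by (rule theI'[OF toeplitz_adjoint_unique[OF N B H]])
  then show "a \<in> carrier_vec (2 * N - 1)" ..
  assume u: "u \<in> carrier_vec (2 * N - 1)"
  have dT: "dim_row (toeplitz N u) = N" "dim_col (toeplitz N u) = N"
    by (auto simp: toeplitz_def)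
  have "complex_of_real (a \<bullet> u) = trace (toeplitz N u * ?B)"
    using * u hermitian_toeplitz by (simp add: hermitian_def)
  also have "\<dots> = (\<Sum>i<N. \<Sum>k<N. toeplitz N u $$ (i, k) * (s $ k * cnj (s $ i)))"
  proof -
    have "(toeplitz N u * ?B) $$ (i, i) = (\<Sum>k<N. toeplitz N u $$ (i, k) * (s $ k * cnj (s $ i)))"
      if "i < N" for i
      using that B by (subst index_mult_mat)
        (auto simp: dT scalar_prod_def[of "row (toeplitz N u) i"] atLeast0LessThan Bi simp del: index_mult_mat)
    then show ?thesis
      by (simp add: trace_def dT del: index_mult_mat(1))
  qed
  also have "\<dots> = (toeplitz N u *\<^sub>v s) \<bullet>c s"
    by (simp add: scalar_prod_def ds dT atLeast0LessThan sum_distrib_left mult_ac)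
  finally show "a \<bullet> u = Re ((toeplitz N u *\<^sub>v s) \<bullet>c s)"
    by (metis Re_complex_of_real)
qed

section \<open>Membership in the cones K and C\<close>

lemma cone_K_iff:
  assumes "x \<in> carrier_vec N" "u \<in> carrier_vec (2 * N - 1)"
  shows "(v, x, u) \<in> cone_K N \<longleftrightarrow> (\<forall>w \<in> carrier_vec N. \<forall>t.
    0 \<le> (toeplitz N u *\<^sub>v w) \<bullet>c w + t * (x \<bullet>c w) + cnj t * (w \<bullet>c x) + t * cnj t * v)"
  using assms psd_bordered_iff[OF toeplitz_carrier assms(1) hermitian_toeplitz]
  by (simp add: cone_K_def)

lemma cone_K_imp_cone_C:
  assumes "(v, x, u) \<in> cone_K N"
  shows "u \<in> cone_C N"
proof -
  have x: "x \<in> carrier_vec N" and u: "u \<in> carrier_vec (2 * N - 1)"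
    using assms by (auto simp: cone_K_def)
  have dT: "dim_row (toeplitz N u) = N" by (simp add: toeplitz_def)
  have "0 \<le> (toeplitz N u *\<^sub>v w) \<bullet>c w" if "w \<in> carrier_vec N" for w
    \<comment> \<open>Setting \<open>t = 0\<close> removes the border and leaves the form of the
      Toeplitz block.\<close>
    using assms[unfolded cone_K_iff[OF x u], rule_format, OF that, of 0] by simp
  then show ?thesis
    using u hermitian_toeplitz by (simp add: cone_C_def psd_def dT)
qed

text \<open>The pairing with this element is \<rho>, so it excludes negative \<rho> from the dual
  cone. Its bordered form at \<open>(w, t)\<close> is just the squared modulus of
  \<open>t\<close>.\<close>

lemma unit_in_cone_K:
  assumes "N \<ge> 1"
  shows "(1, 0\<^sub>v N, 0\<^sub>v (2 * N - 1)) \<in> cone_K N"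
proof -
  have "toeplitz N (0\<^sub>v (2 * N - 1)) = 0\<^sub>m N N"
    using assms by (intro eq_matI) (auto simp: toeplitz_def complex_eq_iff)
  moreover have "0\<^sub>m N N *\<^sub>v w = 0\<^sub>v N" if "w \<in> carrier_vec N" for w :: "complex vec"
    using that by (intro eq_vecI) auto
  ultimately show ?thesis
    by (subst cone_K_iff) (auto simp: less_eq_complex_def simp del: One_nat_def)
qed

text \<open>The factor 1/2 compensates for the diagonal entry \<open>2 * u $ 0\<close>. At this
  \<open>u\<close> the form at \<open>s\<close> is the squared norm of \<open>s\<close>, so its
  vanishing forces \<open>s\<close> to vanish.\<close>

lemma identity_in_cone_C:
  assumes N: "N \<ge> 1"
  defines "u \<equiv> (1 / 2) \<cdot>\<^sub>v unit_vec (2 * N - 1) 0"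
  shows "toeplitz N u = 1\<^sub>m N" and "u \<in> cone_C N"
proof -
  show T: "toeplitz N u = 1\<^sub>m N"
    using N by (intro eq_matI) (auto simp: toeplitz_def u_def complex_eq_iff)
  show "u \<in> cone_C N"
    using hermitian_toeplitz[of N u] T
    by (auto simp: cone_C_def psd_def u_def)
qed

section \<open>Inequalities relating the pairing to the form of T(u) at s\<close>

lemma dual_cone_K_parabola:
  assumes \<lambda>: "(\<rho>, s, z) \<in> dual_cone_K N" and u: "u \<in> cone_C N"
  shows "0 \<le> \<rho> * k\<^sup>2 * Re ((toeplitz N u *\<^sub>v s) \<bullet>c s)
    - k * Re ((toeplitz N u *\<^sub>v s) \<bullet>c s) + z \<bullet> u"
proof -
  \<comment> \<open>The minus sign turns the cross term of the pairing into \<open>- k\<close> times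
    the form at \<open>s\<close>; the corner entry scales with the square of
    \<open>k\<close>.\<close>
  let ?T = "toeplitz N u" and ?y = "complex_of_real (- k) \<cdot>\<^sub>v s"
  have s: "s \<in> carrier_vec N" using \<lambda> by (simp add: dual_cone_K_def)
  have Ts: "?T *\<^sub>v s \<in> carrier_vec N"
    by (rule mult_mat_vec_carrier[OF toeplitz_carrier s])
  have Ty: "?T *\<^sub>v ?y = complex_of_real (- k) \<cdot>\<^sub>v (?T *\<^sub>v s)"
    using s by (simp add: mult_mat_vec[OF toeplitz_carrier])
  have q: "Re ((?T *\<^sub>v ?y) \<bullet>c ?y) = k\<^sup>2 * Re ((?T *\<^sub>v s) \<bullet>c s)"
    unfolding Ty conjugate_smult_vec using s Ts by (simp add: power2_eq_square)
  have "(k\<^sup>2 * Re ((?T *\<^sub>v s) \<bullet>c s), ?T *\<^sub>v ?y, u) \<in> cone_K N"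
    unfolding cone_K_def mem_Collect_eq case_prod_conv
  proof (intro conjI)
    show "psd (bordered ?T (?T *\<^sub>v ?y) (k\<^sup>2 * Re ((?T *\<^sub>v s) \<bullet>c s)))"
      by (rule psd_bordered_mult_vec[OF toeplitz_carrier _ _ q[symmetric]])
        (use u s in \<open>auto simp: cone_C_def\<close>)
    show "?T *\<^sub>v ?y \<in> carrier_vec N"
      unfolding Ty using Ts by simp
  qed (use u in \<open>simp add: cone_C_def\<close>)
  then have "0 \<le> pairing (\<rho>, s, z) (k\<^sup>2 * Re ((?T *\<^sub>v s) \<bullet>c s), ?T *\<^sub>v ?y, u)"
    using \<lambda> by (simp add: dual_cone_K_def)
  moreover have "Re (conjugate s \<bullet> (?T *\<^sub>v ?y)) = - k * Re ((?T *\<^sub>v s) \<bullet>c s)"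
    unfolding Ty conjugate_vec_sprod_comm[OF Ts s]
    using s Ts by (simp add: scalar_prod_smult_distrib[of _ N])
  ultimately show ?thesis
    by (simp add: pairing_def)
qed

lemma cone_K_border_bound:
  assumes \<mu>: "(v, x, u) \<in> cone_K N" and s: "s \<in> carrier_vec N" and \<rho>: "\<rho> > 0"
  shows "- (1 / (4 * \<rho>)) * Re ((toeplitz N u *\<^sub>v s) \<bullet>c s) \<le> \<rho> * v + Re (conjugate s \<bullet> x)"
proof -
  let ?q = "(toeplitz N u *\<^sub>v s) \<bullet>c s"
  have x: "x \<in> carrier_vec N" and u: "u \<in> carrier_vec (2 * N - 1)"
    using \<mu> by (auto simp: cone_K_def)
  have c: "s \<bullet>c x = cnj (x \<bullet>c s)"
    using conjugate_sprod_vec[of x N "conjugate s"] conjugate_vec_sprod_comm[of s N x] x s by simp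
  \<comment> \<open>For a real last entry \<open>t\<close>, the border terms are
    \<open>2 * t * Re (x \<bullet>c s) + t\<^sup>2 * v\<close>. They are proportional to the border
    part of the pairing, \<open>Re (x \<bullet>c s) + \<rho> * v\<close>, exactly when
    \<open>t = 2 * \<rho>\<close>; the common factor is then \<open>4 * \<rho>\<close>.\<close>
  have "0 \<le> ?q + complex_of_real (2 * \<rho>) * (x \<bullet>c s)
      + cnj (complex_of_real (2 * \<rho>)) * (s \<bullet>c x)
      + complex_of_real (2 * \<rho>) * cnj (complex_of_real (2 * \<rho>)) * v"
    using \<mu> s unfolding cone_K_iff[OF x u] by blast
  then have "0 \<le> Re ?q + 4 * \<rho> * Re (x \<bullet>c s) + 4 * \<rho>\<^sup>2 * v"
    unfolding c by (simp add: less_eq_complex_def power2_eq_square)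
  then have "- Re ?q \<le> 4 * \<rho> * (\<rho> * v + Re (x \<bullet>c s))"
    by (simp add: algebra_simps power2_eq_square)
  then have "- Re ?q / (4 * \<rho>) \<le> \<rho> * v + Re (x \<bullet>c s)"
    using \<rho> by (subst pos_divide_le_eq) (auto simp: mult_ac)
  then show ?thesis
    using conjugate_vec_sprod_comm[OF x s] by simp
qed

section \<open>The two inclusions for the dual cone\<close>

lemma dual_cone_K_imp:
  assumes N: "N \<ge> 1" and \<lambda>: "(\<rho>, s, z) \<in> dual_cone_K N"
  shows "\<rho> > 0 \<and> z - (1 / (4 * \<rho>)) \<cdot>\<^sub>v toeplitz_adjoint N (as_column s * mat_adjoint (as_column s))
           \<in> dual_cone_C N \<or> \<rho> = 0 \<and> s = 0\<^sub>v N \<and> z \<in> dual_cone_C N"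
proof -
  let ?q = "\<lambda>u. Re ((toeplitz N u *\<^sub>v s) \<bullet>c s)"
  have s: "s \<in> carrier_vec N" and z: "z \<in> carrier_vec (2 * N - 1)"
    using \<lambda> by (auto simp: dual_cone_K_def)
  have "0 \<le> pairing (\<rho>, s, z) (1, 0\<^sub>v N, 0\<^sub>v (2 * N - 1))"
    using \<lambda> unit_in_cone_K[OF N] by (simp add: dual_cone_K_def)
  then have "\<rho> \<ge> 0"
    using s z by (simp add: pairing_def)
  then consider "\<rho> > 0" | "\<rho> = 0" by linarith
  then show ?thesis
  proof cases
    case 1
    let ?a = "toeplitz_adjoint N (as_column s * mat_adjoint (as_column s))"
    note a = toeplitz_adjoint_rank_one[OF N s]
    have "0 \<le> (z - (1 / (4 * \<rho>)) \<cdot>\<^sub>v ?a) \<bullet> u" if "u \<in> cone_C N" for u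
    proof -
      have u: "u \<in> carrier_vec (2 * N - 1)" using that by (simp add: cone_C_def)
      \<comment> \<open>At this \<open>k\<close> the first two terms add up to
        \<open>- ?q u / (4 * \<rho>)\<close>, which is where the constant in the description of the
        dual cone comes from.\<close>
      have "0 \<le> \<rho> * (1 / (2 * \<rho>))\<^sup>2 * ?q u - 1 / (2 * \<rho>) * ?q u + z \<bullet> u"
        by (rule dual_cone_K_parabola[OF \<lambda> that])
      also have "\<dots> = z \<bullet> u - (1 / (4 * \<rho>)) * ?q u"
        using 1 by (simp add: field_simps power2_eq_square)
      also have "\<dots> = (z - (1 / (4 * \<rho>)) \<cdot>\<^sub>v ?a) \<bullet> u"
        using a u z by (simp add: minus_scalar_prod_distrib[of _ "2 * N - 1"])
      finally show ?thesis .
    qed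
    then show ?thesis
      using 1 z a(1) by (simp add: dual_cone_C_def)
  next
    case 2
    define e where "e = (1 / 2 :: real) \<cdot>\<^sub>v unit_vec (2 * N - 1) 0"
    note e = identity_in_cone_C[OF N, folded e_def]
    \<comment> \<open>Without \<rho> the parabola degenerates to a line in \<open>k\<close>, which
      stays nonnegative only if its slope is zero.\<close>
    have par: "0 \<le> z \<bullet> u - k * ?q u" if "u \<in> cone_C N" for u k
      using dual_cone_K_parabola[OF \<lambda> that, of k] 2 by simp
    have "Re (s \<bullet>c s) = 0"
    proof (rule ccontr)
      assume "Re (s \<bullet>c s) \<noteq> 0"
      then show False
        \<comment> \<open>This \<open>k\<close> makes the right-hand side of \<open>par\<close>
          equal to -1. The division is legitimate because \<open>?q e\<close> is
          \<open>Re (s \<bullet>c s)\<close>, assumed nonzero.\<close>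
        using par[OF e(2), of "(z \<bullet> e + 1) / ?q e"] e(1) s by simp
    qed
    moreover have "Im (s \<bullet>c s) = 0"
      using conjugate_square_ge_0_vec[of s] by (simp add: less_eq_complex_def)
    ultimately have "s = 0\<^sub>v N"
      using s by (metis complex_eqI conjugate_square_eq_0_vec zero_complex.simps)
    moreover have "z \<in> dual_cone_C N"
      \<comment> \<open>With \<open>k = 0\<close> only \<open>z \<bullet> u\<close> remains.\<close>
      using par[of _ 0] z by (simp add: dual_cone_C_def)
    ultimately show ?thesis
      using 2 by simp
  qed
qed

text \<open>The border part of the pairing can fall below zero by at most the form of T(u) at
  \<open>s\<close> divided by \<open>4 * \<rho>\<close>. Since \<open>u\<close> lies in C, the
  hypothesis on \<open>z\<close> makes \<open>z \<bullet> u\<close> large enough to absorb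
  this.\<close>

lemma dual_cone_K_if_pos:
  assumes N: "N \<ge> 1" and s: "s \<in> carrier_vec N" and z: "z \<in> carrier_vec (2 * N - 1)"
    and \<rho>: "\<rho> > 0"
    and C: "z - (1 / (4 * \<rho>)) \<cdot>\<^sub>v toeplitz_adjoint N (as_column s * mat_adjoint (as_column s))
      \<in> dual_cone_C N"
  shows "(\<rho>, s, z) \<in> dual_cone_K N"
proof -
  let ?a = "toeplitz_adjoint N (as_column s * mat_adjoint (as_column s))"
  note a = toeplitz_adjoint_rank_one[OF N s]
  have "0 \<le> pairing (\<rho>, s, z) (v, x, u)" if \<mu>: "(v, x, u) \<in> cone_K N" for v x u
  proof -
    have u: "u \<in> carrier_vec (2 * N - 1)" using \<mu> by (simp add: cone_K_def)
    have "0 \<le> (z - (1 / (4 * \<rho>)) \<cdot>\<^sub>v ?a) \<bullet> u"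
      using C cone_K_imp_cone_C[OF \<mu>] by (simp add: dual_cone_C_def)
    also have "\<dots> = z \<bullet> u - (1 / (4 * \<rho>)) * Re ((toeplitz N u *\<^sub>v s) \<bullet>c s)"
      using a u z by (simp add: minus_scalar_prod_distrib[of _ "2 * N - 1"])
    finally show ?thesis
      using cone_K_border_bound[OF \<mu> s \<rho>] by (simp add: pairing_def)
  qed
  then show ?thesis
    using s z by (auto simp: dual_cone_K_def)
qed

lemma dual_cone_K_if_zero:
  assumes "z \<in> dual_cone_C N"
  shows "(0, 0\<^sub>v N, z) \<in> dual_cone_K N"
proof -
  have "0 \<le> pairing (0, 0\<^sub>v N, z) (v, x, u)" if \<mu>: "(v, x, u) \<in> cone_K N" for v x u
  proof -
    have "x \<in> carrier_vec N" using \<mu> by (simp add: cone_K_def)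
    then show ?thesis
      using assms cone_K_imp_cone_C[OF \<mu>] by (simp add: pairing_def dual_cone_C_def)
  qed
  then show ?thesis
    using assms by (auto simp: dual_cone_K_def dual_cone_C_def)
qed

theorem lemma1:
  fixes N :: nat
  assumes "N \<ge> 1"
  shows "dual_cone_K N =
      {(\<rho>, s, z). s \<in> carrier_vec N \<and> z \<in> carrier_vec (2 * N - 1) \<and> \<rho> > 0 \<and>
         z - (1 / (4 * \<rho>)) \<cdot>\<^sub>v toeplitz_adjoint N (as_column s * mat_adjoint (as_column s))
           \<in> dual_cone_C N}
    \<union> {(\<rho>, s, z). s \<in> carrier_vec N \<and> z \<in> carrier_vec (2 * N - 1) \<and> \<rho> = 0 \<and>
         s = 0\<^sub>v N \<and> z \<in> dual_cone_C N}"
proof (intro equalityI subsetI)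
  fix l
  assume l: "l \<in> dual_cone_K N"
  obtain \<rho> s z where eq: "l = (\<rho>, s, z)" by (cases l)
  have "s \<in> carrier_vec N" "z \<in> carrier_vec (2 * N - 1)"
    using l by (auto simp: eq dual_cone_K_def)
  with dual_cone_K_imp[OF assms l[unfolded eq]] show "l \<in> {(\<rho>, s, z). s \<in> carrier_vec N \<and>
      z \<in> carrier_vec (2 * N - 1) \<and> \<rho> > 0 \<and>
      z - (1 / (4 * \<rho>)) \<cdot>\<^sub>v toeplitz_adjoint N (as_column s * mat_adjoint (as_column s))
        \<in> dual_cone_C N}
    \<union> {(\<rho>, s, z). s \<in> carrier_vec N \<and> z \<in> carrier_vec (2 * N - 1) \<and> \<rho> = 0 \<and>
         s = 0\<^sub>v N \<and> z \<in> dual_cone_C N}"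
    unfolding eq by blast
qed (auto intro: dual_cone_K_if_pos[OF assms] dual_cone_K_if_zero)

end
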